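(* Let $\mathcal{M}_*$ be the Gromov space of isometry classes of pointed proper metric spaces, let $E_{GH}$ and $E_{QI}$ be, respectively, the Gromov-Hausdorff relation and the quasi-isometric relation on $\mathcal{M}_*$, and let $E_{K_\sigma}$ be the equivalence relation on $\prod_{n=2}^\infty\{1,\dots,n\}$ consisting of the pairs $(x,y)$, with $x=(x_n)$ and $y=(y_n)$, such that $\sup_n|x_n-y_n|<\infty$. Then $E_{K_\sigma}\le_c E_{GH}$ and $E_{K_\sigma}\le_c E_{QI}$; that is, $E_{K_\sigma}$ is continuously reducible to $E_{GH}$ and to $E_{QI}$.
   Context: The set $\prod_{n=2}^\infty\{1,\dots,n\}$ carries the product topology of the discrete topologies on the factors. Metrics are finite-valued. A metric space is proper if every open ball has compact closure (equivalently, closed balls are compact). $\mathcal{M}_*$ is the set of isometry classes $[M,x]$ of pointed proper metric spaces $(M,x)$ (isometries being onto and preserving distinguished points). Admissible metrics: for metric spaces $M,N$, a metric on the disjoint union $M\sqcup N$ is admissible if it restricts to $d_M$ on $M$ and to $d_N$ on $N$. Topology of $\mathcal{M}_*$: for subspaces $M,N$ of a metric space with metric $d$, points $x\in M$, $y\in N$, and $R>0$, put $$H_{d,R}(M,x;N,y)=\max\Bigl\{\sup_{u\in B_M(x,R)}d(u,N),\ \sup_{v\in B_N(y,R)}d(v,M)\Bigr\},$$ where $B_M(x,R)$ is the open ball in $M$ of center $x$ and radius $R$. For $R,r>0$, let $U_{R,r}\subset\mathcal{M}_*\times\mathcal{M}_*$ be the set of pairs $([M,x],[N,y])$ for which there is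 an admissible metric $d$ on $M\sqcup N$ with $\max\{d(x,y),H_{d,R}(M,x;N,y)\}<r$. The sets $U_{R,r}$ form a base of entourages of a metrizable uniformity on $\mathcal{M}_*$, and $\mathcal{M}_*$ carries the induced topology (it is a Polish space). Gromov-Hausdorff relation: $d_{GH}(M,N)=\inf_d H_d(M,N)$, where $d$ runs over admissible metrics on $M\sqcup N$ and $H_d(A,B)=\max\{\sup_{a\in A}\inf_{b\in B}d(a,b),\ \sup_{b\in B}\inf_{a\in A}d(a,b)\}$ is the Hausdorff distance (possibly infinite). $E_{GH}$ consists of the pairs $([M,x],[N,y])\in\mathcal{M}_*^2$ with $d_{GH}(M,N)<\infty$. Quasi-isometric relation: a subset $A\subset M$ is a net if there is $C\ge 0$ such that $d_M(x,A)\le C$ for all $x\in M$. A map $\phi$ between metric spaces is bi-Lipschitz if there is $\lambda\ge1$ with $\lambda^{-1}d(u,v)\le d(\phi(u),\phi(v))\le\lambda\, d(u,v)$ for all $u,v$. A (coarse) quasi-isometry of $M$ to $N$ is a bi-Lipschitz bijection $\phi:A\to B$ for some nets $A\subset M$ and $B\subset N$. $E_{QI}$ consists of the pairs $([M,x],[N,y])\in\mathcal{M}_*^2$ such that there is a quasi-isometry of $M$ to $N$. Continuous reducibility: for equivalence relations $E$ on a topological space $X$ and $F$ on a topological space $Y$, $E\le_c F$ means that there is a continuous map $\theta:X\to Y$ such that $x\,E\,x'\Leftrightarrow\theta(x)\,F\,\theta(x')$ for all $x,x'\in X$. *)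

theory Defs
  imports "HOL-Analysis.Analysis"
begin

section \<open>Pointed proper metric spaces and their isometry classes\<close>

definition proper_metric :: "'a metric \<Rightarrow> bool" where
  "proper_metric M \<longleftrightarrow>
     (\<forall>x\<in>mspace M. \<forall>r. compactin (mtopology_of M) (mtopology_of M closure_of mball_of M x r))"

definition pointed_proper :: "('a metric \<times> 'a) set" where
  "pointed_proper = {(M, x). proper_metric M \<and> x \<in> mspace M}"

definition pointed_isometric :: "'a metric \<times> 'a \<Rightarrow> 'b metric \<times> 'b \<Rightarrow> bool" where
  "pointed_isometric = (\<lambda>(M, x) (N, y). \<exists>f. f ` mspace M = mspace N \<and> f x = y \<and>
     (\<forall>u\<in>mspace M. \<forall>v\<in>mspace M. mdist N (f u) (f v) = mdist M u v))"

text \<open>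
  Isometry classes are formed inside the type of metric spaces whose points are real numbers.
  This loses nothing: a pointed proper metric space over any type is isometric to one whose
  underlying set is a set of reals; see \<open>pointed_proper_real_model\<close> below.
\<close>

definition pointed_isometry_rel :: "((real metric \<times> real) \<times> (real metric \<times> real)) set" where
  "pointed_isometry_rel =
     {(p, q). p \<in> pointed_proper \<and> q \<in> pointed_proper \<and> pointed_isometric p q}"

definition isometry_class :: "real metric \<Rightarrow> real \<Rightarrow> (real metric \<times> real) set" where
  "isometry_class M x = pointed_isometry_rel `` {(M, x)}"

definition gromov_space :: "(real metric \<times> real) set set" where
  "gromov_space = pointed_proper // pointed_isometry_rel"


section \<open>Admissible metrics and Hausdorff distances\<close>

text \<open>
  The disjoint union of \<open>M\<close> and \<open>N\<close> is \<open>mspace M <+> mspace N\<close>, with inclusions \<open>Inl\<close> and \<open>Inr\<close>.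
\<close>

definition admissible_metrics :: "'a metric \<Rightarrow> 'b metric \<Rightarrow> ('a + 'b) metric set" where
  "admissible_metrics M N = {D. mspace D = mspace M <+> mspace N \<and>
     (\<forall>u\<in>mspace M. \<forall>v\<in>mspace M. mdist D (Inl u) (Inl v) = mdist M u v) \<and>
     (\<forall>u\<in>mspace N. \<forall>v\<in>mspace N. mdist D (Inr u) (Inr v) = mdist N u v)}"

text \<open>Distances to sets are extended reals; the distance to the empty set is \<open>\<infinity>\<close>.\<close>

definition point_set_dist :: "'a metric \<Rightarrow> 'a \<Rightarrow> 'a set \<Rightarrow> ennreal" where
  "point_set_dist D u A = (INF v\<in>A. ennreal (mdist D u v))"

definition hausdorff_dist :: "'a metric \<Rightarrow> 'a set \<Rightarrow> 'a set \<Rightarrow> ennreal" where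
  "hausdorff_dist D A B =
     max (SUP a\<in>A. point_set_dist D a B) (SUP b\<in>B. point_set_dist D b A)"

definition local_hausdorff_dist ::
    "'a metric \<Rightarrow> real \<Rightarrow> 'a set \<Rightarrow> 'a \<Rightarrow> 'a set \<Rightarrow> 'a \<Rightarrow> ennreal" where
  "local_hausdorff_dist D R A x B y =
     max (SUP u\<in>A \<inter> mball_of D x R. point_set_dist D u B)
         (SUP v\<in>B \<inter> mball_of D y R. point_set_dist D v A)"

definition gromov_hausdorff_dist :: "'a metric \<Rightarrow> 'b metric \<Rightarrow> ennreal" where
  "gromov_hausdorff_dist M N =
     (INF D\<in>admissible_metrics M N. hausdorff_dist D (Inl ` mspace M) (Inr ` mspace N))"


section \<open>The topology of the Gromov space\<close>

definition gromov_entourage ::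
    "real \<Rightarrow> real \<Rightarrow> ((real metric \<times> real) set \<times> (real metric \<times> real) set) set" where
  "gromov_entourage R r =
     {(isometry_class M x, isometry_class N y) | M x N y.
        (M, x) \<in> pointed_proper \<and> (N, y) \<in> pointed_proper \<and>
        (\<exists>D\<in>admissible_metrics M N.
           max (ennreal (mdist D (Inl x) (Inr y)))
               (local_hausdorff_dist D R (Inl ` mspace M) (Inl x) (Inr ` mspace N) (Inr y))
             < ennreal r)}"

definition gromov_topology :: "(real metric \<times> real) set topology" where
  "gromov_topology = topology (\<lambda>U. U \<subseteq> gromov_space \<and>
     (\<forall>p\<in>U. \<exists>R>0. \<exists>r>0. gromov_entourage R r `` {p} \<subseteq> U))"


section \<open>The equivalence relations\<close>

definition GH_relation :: "((real metric \<times> real) set \<times> (real metric \<times> real) set) set" where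
  "GH_relation =
     {(isometry_class M x, isometry_class N y) | M x N y.
        (M, x) \<in> pointed_proper \<and> (N, y) \<in> pointed_proper \<and>
        gromov_hausdorff_dist M N < \<infinity>}"

definition is_net :: "'a metric \<Rightarrow> 'a set \<Rightarrow> bool" where
  "is_net M A \<longleftrightarrow> A \<subseteq> mspace M \<and>
     (\<exists>C::real. C \<ge> 0 \<and> (\<forall>x\<in>mspace M. point_set_dist M x A \<le> ennreal C))"

definition bi_Lipschitz_on :: "'a metric \<Rightarrow> 'b metric \<Rightarrow> 'a set \<Rightarrow> ('a \<Rightarrow> 'b) \<Rightarrow> bool" where
  "bi_Lipschitz_on M N A \<phi> \<longleftrightarrow> (\<exists>L::real. L \<ge> 1 \<and> (\<forall>u\<in>A. \<forall>v\<in>A.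
     inverse L * mdist M u v \<le> mdist N (\<phi> u) (\<phi> v) \<and>
     mdist N (\<phi> u) (\<phi> v) \<le> L * mdist M u v))"

definition quasi_isometric :: "'a metric \<Rightarrow> 'b metric \<Rightarrow> bool" where
  "quasi_isometric M N \<longleftrightarrow> (\<exists>A B \<phi>. is_net M A \<and> is_net N B \<and>
     bij_betw \<phi> A B \<and> bi_Lipschitz_on M N A \<phi>)"

definition QI_relation :: "((real metric \<times> real) set \<times> (real metric \<times> real) set) set" where
  "QI_relation =
     {(isometry_class M x, isometry_class N y) | M x N y.
        (M, x) \<in> pointed_proper \<and> (N, y) \<in> pointed_proper \<and> quasi_isometric M N}"

definition Ksigma_space :: "(nat \<Rightarrow> nat) topology" where
  "Ksigma_space = product_topology (\<lambda>n. discrete_topology {1..n}) {2..}"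

definition Ksigma_relation :: "((nat \<Rightarrow> nat) \<times> (nat \<Rightarrow> nat)) set" where
  "Ksigma_relation = {(x, y). x \<in> topspace Ksigma_space \<and> y \<in> topspace Ksigma_space \<and>
     (SUP n\<in>{2..}. ennreal \<bar>real (x n) - real (y n)\<bar>) < \<infinity>}"

definition continuously_reducible ::
    "'a topology \<Rightarrow> ('a \<times> 'a) set \<Rightarrow> 'b topology \<Rightarrow> ('b \<times> 'b) set \<Rightarrow> bool" where
  "continuously_reducible X E Y F \<longleftrightarrow> (\<exists>\<theta>. continuous_map X Y \<theta> \<and>
     (\<forall>x\<in>topspace X. \<forall>x'\<in>topspace X. (x, x') \<in> E \<longleftrightarrow> (\<theta> x, \<theta> x') \<in> F))"


section \<open>Adequacy of the definitions\<close>

lemma pointed_isometric_refl: "pointed_isometric p p"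
  unfolding pointed_isometric_def by (cases p) (auto intro!: exI[of _ id])

lemma pointed_isometric_sym:
  assumes "pointed_isometric (M, x) (N, y)" "x \<in> mspace M"
  shows "pointed_isometric (N, y) (M, x)"
proof -
  obtain f where f: "f ` mspace M = mspace N" "f x = y"
      "\<And>u v. u \<in> mspace M \<Longrightarrow> v \<in> mspace M \<Longrightarrow> mdist N (f u) (f v) = mdist M u v"
    using assms(1) unfolding pointed_isometric_def by auto
  have inj: "inj_on f (mspace M)"
  proof (rule inj_onI)
    fix u v assume uv: "u \<in> mspace M" "v \<in> mspace M" "f u = f v"
    then have "f v \<in> mspace N" using f(1) by auto
    then have "mdist N (f u) (f v) = 0" unfolding uv(3) by simp
    then have "mdist M u v = 0" using f(3)[OF uv(1,2)] by simp
    then show "u = v" using mdist_zero[OF uv(1,2)] by simp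
  qed
  let ?g = "inv_into (mspace M) f"
  have 1: "?g ` mspace N = mspace M"
    using inj f(1) by (metis inv_into_image_cancel order_refl)
  have 2: "?g y = x" using inj assms(2) f(2) by (metis inv_into_f_f)
  have "mdist M (?g u) (?g v) = mdist N u v" if "u \<in> mspace N" "v \<in> mspace N" for u v
    using that f(1,3) by (metis f_inv_into_f inv_into_into)
  with 1 2 show ?thesis unfolding pointed_isometric_def by auto
qed

lemma pointed_isometric_trans:
  assumes "pointed_isometric p q" "pointed_isometric q s"
  shows "pointed_isometric p s"
proof -
  obtain M x N y P z where [simp]: "p = (M, x)" "q = (N, y)" "s = (P, z)"
    by (metis surj_pair)
  obtain f where f: "f ` mspace M = mspace N" "f x = y"
      "\<And>u v. u \<in> mspace M \<Longrightarrow> v \<in> mspace M \<Longrightarrow> mdist N (f u) (f v) = mdist M u v"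
    using assms(1) unfolding pointed_isometric_def by auto
  obtain g where g: "g ` mspace N = mspace P" "g y = z"
      "\<And>u v. u \<in> mspace N \<Longrightarrow> v \<in> mspace N \<Longrightarrow> mdist P (g u) (g v) = mdist N u v"
    using assms(2) unfolding pointed_isometric_def by auto
  have "(g \<circ> f) ` mspace M = mspace P"
    unfolding f(1)[symmetric] g(1)[symmetric] by (rule image_comp[symmetric])
  moreover have "(g \<circ> f) x = z"
    using f(2) g(2) by simp
  moreover have "mdist P ((g \<circ> f) u) ((g \<circ> f) v) = mdist M u v"
    if "u \<in> mspace M" "v \<in> mspace M" for u v
    using that f(1,3) g(3) by (metis comp_apply imageI)
  ultimately show ?thesis
    unfolding pointed_isometric_def prod.case \<open>p = (M, x)\<close> \<open>s = (P, z)\<close> by blast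
qed

lemma equiv_pointed_isometry_rel: "equiv pointed_proper pointed_isometry_rel"
proof (rule equivI)
  show "pointed_isometry_rel \<subseteq> pointed_proper \<times> pointed_proper"
    by (auto simp: pointed_isometry_rel_def)
  show "refl_on pointed_proper pointed_isometry_rel"
    by (auto simp: refl_on_def pointed_isometry_rel_def pointed_isometric_refl)
  show "sym pointed_isometry_rel"
    by (auto simp: sym_def pointed_isometry_rel_def pointed_proper_def
        intro: pointed_isometric_sym)
  show "trans pointed_isometry_rel"
    unfolding trans_def pointed_isometry_rel_def by (blast intro: pointed_isometric_trans)
qed

lemma gromov_space_eq:
  "gromov_space = {isometry_class M x | M x. (M, x) \<in> pointed_proper}"
proof -
  have "gromov_space = (\<lambda>p. pointed_isometry_rel `` {p}) ` pointed_proper"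
    unfolding gromov_space_def quotient_def by (rule UNION_singleton_eq_range)
  also have "\<dots> = {isometry_class M x | M x. (M, x) \<in> pointed_proper}"
    by (auto simp: isometry_class_def image_iff Bex_def)
  finally show ?thesis .
qed

lemma gromov_entourage_mono:
  assumes "R \<le> R'" "r' \<le> r"
  shows "gromov_entourage R' r' \<subseteq> gromov_entourage R r"
proof -
  have ball: "mball_of D a R \<subseteq> mball_of D a R'" for D :: "(real + real) metric" and a
    using assms(1) by auto
  have H: "local_hausdorff_dist D R A a B b \<le> local_hausdorff_dist D R' A a B b"
    for D :: "(real + real) metric" and A a B b
    unfolding local_hausdorff_dist_def
    by (intro max.mono SUP_subset_mono) (use ball in blast)+
  have "max c (local_hausdorff_dist D R A a B b) < ennreal r"
    if "max c (local_hausdorff_dist D R' A a B b) < ennreal r'"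
    for D :: "(real + real) metric" and A a B b c
  proof -
    have "max c (local_hausdorff_dist D R A a B b) \<le> max c (local_hausdorff_dist D R' A a B b)"
      by (rule max.mono[OF order.refl H])
    also note that
    also have "ennreal r' \<le> ennreal r" by (rule ennreal_leI[OF assms(2)])
    finally show ?thesis .
  qed
  then have "\<exists>D\<in>admissible_metrics M N. max (ennreal (mdist D (Inl x) (Inr y)))
      (local_hausdorff_dist D R (Inl ` mspace M) (Inl x) (Inr ` mspace N) (Inr y)) < ennreal r"
    if "\<exists>D\<in>admissible_metrics M N. max (ennreal (mdist D (Inl x) (Inr y)))
      (local_hausdorff_dist D R' (Inl ` mspace M) (Inl x) (Inr ` mspace N) (Inr y)) < ennreal r'"
    for M N :: "real metric" and x y
    using that by (meson bexE bexI)
  then show ?thesis unfolding gromov_entourage_def by (intro Collect_mono ex_mono) simp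
qed

lemma openin_gromov_topology:
  "openin gromov_topology U \<longleftrightarrow> U \<subseteq> gromov_space \<and>
     (\<forall>p\<in>U. \<exists>R>0. \<exists>r>0. gromov_entourage R r `` {p} \<subseteq> U)"
proof -
  let ?P = "\<lambda>U. U \<subseteq> gromov_space \<and>
     (\<forall>p\<in>U. \<exists>R>0. \<exists>r>0. gromov_entourage R r `` {p} \<subseteq> U)"
  have "istopology ?P"
    unfolding istopology_def
  proof (intro conjI allI impI)
    fix S T assume S: "?P S" and T: "?P T"
    show "S \<inter> T \<subseteq> gromov_space" using S by blast
    show "\<forall>p\<in>S \<inter> T. \<exists>R>0. \<exists>r>0. gromov_entourage R r `` {p} \<subseteq> S \<inter> T"
    proof
      fix p assume p: "p \<in> S \<inter> T"
      obtain R r where 1: "R > 0" "r > 0" "gromov_entourage R r `` {p} \<subseteq> S"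
        using S p by blast
      obtain R' r' where 2: "R' > 0" "r' > 0" "gromov_entourage R' r' `` {p} \<subseteq> T"
        using T p by blast
      have "gromov_entourage (max R R') (min r r') `` {p} \<subseteq> S \<inter> T"
        using 1(3) 2(3) gromov_entourage_mono[of R "max R R'" "min r r'" r]
          gromov_entourage_mono[of R' "max R R'" "min r r'" r'] by auto
      moreover have "max R R' > 0" "min r r' > 0" using 1 2 by auto
      ultimately show "\<exists>R>0. \<exists>r>0. gromov_entourage R r `` {p} \<subseteq> S \<inter> T" by blast
    qed
  next
    fix K assume K: "\<forall>S\<in>K. ?P S"
    show "\<Union>K \<subseteq> gromov_space" using K by blast
    show "\<forall>p\<in>\<Union>K. \<exists>R>0. \<exists>r>0. gromov_entourage R r `` {p} \<subseteq> \<Union>K"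
    proof
      fix p assume "p \<in> \<Union>K"
      then obtain S where S: "S \<in> K" "p \<in> S" by blast
      then obtain R r where "R > 0" "r > 0" "gromov_entourage R r `` {p} \<subseteq> S"
        using K by blast
      then show "\<exists>R>0. \<exists>r>0. gromov_entourage R r `` {p} \<subseteq> \<Union>K" using S by blast
    qed
  qed
  then show ?thesis unfolding gromov_topology_def by (simp add: topology_inverse')
qed

lemma topspace_gromov_topology [simp]: "topspace gromov_topology = gromov_space"
proof
  show "topspace gromov_topology \<subseteq> gromov_space"
    using openin_gromov_topology openin_topspace by blast
  have "gromov_entourage 1 1 `` {p} \<subseteq> gromov_space" for p
    unfolding gromov_space_eq gromov_entourage_def by blast
  then have "openin gromov_topology gromov_space"
    unfolding openin_gromov_topology using zero_less_one by blast
  then show "gromov_space \<subseteq> topspace gromov_topology" by (rule openin_subset)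
qed

lemma proper_metric_separable:
  assumes "proper_metric M" "x \<in> mspace M"
  obtains D where "countable D" "D \<subseteq> mspace M"
    "\<And>u e. u \<in> mspace M \<Longrightarrow> e > 0 \<Longrightarrow> \<exists>v\<in>D. mdist M u v < e"
proof -
  interpret Metric_space "mspace M" "mdist M" by simp
  have "\<exists>K. finite K \<and> K \<subseteq> mspace M \<and> mball_of M x (real m) \<subseteq> (\<Union>k\<in>K. mball_of M k (1 / real (Suc n)))"
    for m n
  proof -
    have "compactin mtopology (mtopology closure_of mball_of M x (real m))"
      using assms unfolding proper_metric_def mtopology_of_def by blast
    then have "mtotally_bounded (mtopology closure_of mball_of M x (real m))"
      by (rule compactin_imp_mtotally_bounded)
    then obtain K where K: "finite K" "K \<subseteq> mtopology closure_of mball_of M x (real m)"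
        "mtopology closure_of mball_of M x (real m) \<subseteq> (\<Union>k\<in>K. mball k (1 / real (Suc n)))"
      unfolding mtotally_bounded_def by (metis divide_pos_pos of_nat_0_less_iff zero_less_Suc zero_less_one)
    have "mball_of M x (real m) \<subseteq> mtopology closure_of mball_of M x (real m)"
      by (rule closure_of_subset) (auto simp: mball_of_def)
    then have "mball_of M x (real m) \<subseteq> (\<Union>k\<in>K. mball_of M k (1 / real (Suc n)))"
      using K(3) unfolding mball_of_def by (rule subset_trans)
    moreover have "K \<subseteq> mspace M"
      using K(2) closure_of_subset_topspace[of mtopology] by (metis subset_trans topspace_mtopology)
    ultimately show ?thesis using K(1) by blast
  qed
  then obtain K where K: "\<And>m n. finite (K m n)" "\<And>m n. K m n \<subseteq> mspace M"
      "\<And>m n. mball_of M x (real m) \<subseteq> (\<Union>k\<in>K m n. mball_of M k (1 / real (Suc n)))"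
    by metis
  show thesis
  proof
    show "countable (\<Union>m n. K m n)" using K(1) by (intro countable_UN) (auto simp: countable_finite)
    show "(\<Union>m n. K m n) \<subseteq> mspace M" using K(2) by blast
    fix u and e :: real assume u: "u \<in> mspace M" and "e > 0"
    obtain n where n: "1 / real (Suc n) < e" using \<open>e > 0\<close> by (metis nat_approx_posE)
    obtain m where "mdist M x u < real m" using reals_Archimedean2 by blast
    then have "u \<in> mball_of M x (real m)" using u assms(2) by simp
    then obtain k where "k \<in> K m n" "u \<in> mball_of M k (1 / real (Suc n))" using K(3) by blast
    then show "\<exists>v\<in>(\<Union>m n. K m n). mdist M u v < e"
      using n by (intro bexI[of _ k]) (auto simp: mdist_commute)
  qed
qed

theorem pointed_proper_real_model:
  fixes p :: "'a metric \<times> 'a"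
  assumes "p \<in> pointed_proper"
  obtains q :: "real metric \<times> real" where "q \<in> pointed_proper" "pointed_isometric p q"
proof -
  obtain M x where p: "p = (M, x)" by force
  have M: "proper_metric M" and x: "x \<in> mspace M"
    using assms unfolding p pointed_proper_def by auto
  obtain D where D: "countable D" "D \<subseteq> mspace M"
      "\<And>u e. u \<in> mspace M \<Longrightarrow> e > 0 \<Longrightarrow> \<exists>v\<in>D. mdist M u v < e"
    using proper_metric_separable[OF M x] by blast
  have "D \<noteq> {}" using D(3)[OF x, of 1] by auto
  define a where "a = from_nat_into D"
  have a: "range a = D" using D(1) \<open>D \<noteq> {}\<close> by (simp add: a_def range_from_nat_into)
  define f where "f u = {to_nat (i, q :: rat) | i q. mdist M u (a i) < of_rat q}" for u
  have f_inj: "inj_on f (mspace M)"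
  proof (rule inj_onI, rule ccontr)
    fix u v assume uv: "u \<in> mspace M" "v \<in> mspace M" "f u = f v" "u \<noteq> v"
    define e where "e = mdist M u v / 2"
    have "e > 0" using uv mdist_nonneg[of M u v] mdist_zero[of u M v] by (simp add: e_def less_le)
    then obtain w where w: "w \<in> D" "mdist M u w < e" using D(3)[OF uv(1)] by blast
    then obtain i where i: "w = a i" using a by blast
    obtain q :: rat where q: "mdist M u w < of_rat q" "of_rat q < e"
      using w(2) of_rat_dense by blast
    have "to_nat (i, q) \<in> f u" using q(1) i unfolding f_def by blast
    then have "to_nat (i, q) \<in> f v" using uv(3) by simp
    then have "mdist M v w < of_rat q" unfolding f_def i by auto
    moreover have "mdist M u v \<le> mdist M u w + mdist M w v"
      using mdist_triangle[of u M w v] uv w D(2) by blast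
    ultimately show False using q w by (simp add: e_def mdist_commute)
  qed
  obtain h :: "nat set \<Rightarrow> real" where h: "inj h"
    using nat_sets_eqpoll_reals by (metis bij_betw_def eqpoll_def)
  define g where "g = h \<circ> f"
  have g: "inj_on g (mspace M)"
    using f_inj h by (simp add: g_def comp_inj_on inj_on_subset)
  define k where "k = inv_into (mspace M) g"
  have k: "\<And>u. u \<in> mspace M \<Longrightarrow> k (g u) = u" using g by (simp add: k_def)
  define d where "d u v = mdist M (k u) (k v)" for u v
  have ms: "Metric_space (g ` mspace M) d"
    unfolding Metric_space_def by (auto simp: d_def k mdist_commute mdist_triangle)
  define N where "N = metric (g ` mspace M, d)"
  have N: "mspace N = g ` mspace M" "mdist N = d"
    using ms by (simp_all add: N_def Metric_space.mspace_metric Metric_space.mdist_metric)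
  have iso: "pointed_isometric (M, x) (N, g x)"
    unfolding pointed_isometric_def prod.case
    by (rule exI[of _ g]) (auto simp: N d_def k)
  have "homeomorphic_map (mtopology_of M) (mtopology_of N) g"
  proof -
    interpret Metric_space12 "mspace M" "mdist M" "mspace N" "mdist N"
      by (simp add: Metric_space12_def)
    show ?thesis unfolding mtopology_of_def
      by (rule isometry_imp_homeomorphic_map) (auto simp: N d_def k)
  qed
  then have hom: "homeomorphic_map (mtopology_of M) (mtopology_of N) g" .
  have "compactin (mtopology_of N) (mtopology_of N closure_of mball_of N y r)"
    if "y \<in> mspace N" for y r
  proof -
    obtain z where z: "z \<in> mspace M" "y = g z" using \<open>y \<in> mspace N\<close> N(1) by auto
    have B: "mball_of N y r = g ` mball_of M z r"
      using z by (auto simp: N d_def k)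
    have sub: "mball_of M z r \<subseteq> topspace (mtopology_of M)" by auto
    have "mtopology_of N closure_of mball_of N y r = g ` (mtopology_of M closure_of mball_of M z r)"
      unfolding B using homeomorphic_map_closure_of[OF hom sub] by simp
    moreover have "compactin (mtopology_of M) (mtopology_of M closure_of mball_of M z r)"
      using M z unfolding proper_metric_def by blast
    ultimately show ?thesis
      using image_compactin[OF _ homeomorphic_imp_continuous_map[OF hom]] by simp
  qed
  then have "(N, g x) \<in> pointed_proper"
    using x by (auto simp: pointed_proper_def proper_metric_def N)
  then show thesis using that iso p by blast
qed

end

theory Submission
  imports Defs
begin

text \<open>
  A sequence \<open>x\<close> is coded by the set of reals consisting of the pairs \<open>2^(n^2)\<close>,
  \<open>2^(n^2) + g n (x n)\<close>, pointed at its least element. The pairs are so far apart that a coarse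
  embedding between two such sets must map all but finitely many pairs onto the corresponding pairs,
  and it can change their gaps only by a bounded amount, respectively by a bounded factor. So
  \<open>g n k = n + k\<close> yields the reduction to the Gromov-Hausdorff relation and \<open>g n k = 2^(n + k)\<close> the
  reduction to the quasi-isometric relation; the summand \<open>n\<close> makes the gaps tend to infinity.
  The coding is continuous because a bounded part of the set depends only on finitely many terms.
\<close>

section \<open>Coarse embeddings\<close>

text \<open>A common weakening of both relations. \<open>L\<close> is a parameter because the
  Gromov-Hausdorff case needs it to be exactly 1, while the additive error \<open>C\<close> only has
  to exist.\<close>

definition coarsely_embeds :: "real \<Rightarrow> 'a metric \<Rightarrow> 'b metric \<Rightarrow> bool" where
  "coarsely_embeds L M N \<longleftrightarrow> (\<exists>F C. F ` mspace M \<subseteq> mspace N \<and>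
     (\<forall>u\<in>mspace M. \<forall>v\<in>mspace M. mdist M u v / L - C \<le> mdist N (F u) (F v) \<and>
        mdist N (F u) (F v) \<le> L * mdist M u v + C))"

text \<open>Compose with the isometries on both sides; hence the first one goes into
  \<open>M'\<close> and the second one comes out of \<open>N'\<close>.\<close>

lemma coarsely_embeds_isometric:
  assumes "coarsely_embeds L M' N'" "pointed_isometric (M, a) (M', a')"
    "pointed_isometric (N', b') (N, b)"
  shows "coarsely_embeds L M N"
proof -
  obtain F C where F: "F ` mspace M' \<subseteq> mspace N'"
    "\<And>u v. u \<in> mspace M' \<Longrightarrow> v \<in> mspace M' \<Longrightarrow> mdist M' u v / L - C \<le> mdist N' (F u) (F v) \<and>
        mdist N' (F u) (F v) \<le> L * mdist M' u v + C"
    using assms(1) unfolding coarsely_embeds_def by blast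
  obtain f where f: "f ` mspace M = mspace M'"
    "\<And>u v. u \<in> mspace M \<Longrightarrow> v \<in> mspace M \<Longrightarrow> mdist M' (f u) (f v) = mdist M u v"
    using assms(2) unfolding pointed_isometric_def by auto
  obtain g where g: "g ` mspace N' = mspace N"
    "\<And>u v. u \<in> mspace N' \<Longrightarrow> v \<in> mspace N' \<Longrightarrow> mdist N (g u) (g v) = mdist N' u v"
    using assms(3) unfolding pointed_isometric_def by auto
  have "mdist N (g (F (f u))) (g (F (f v))) = mdist N' (F (f u)) (F (f v))"
    if "u \<in> mspace M" "v \<in> mspace M" for u v
    using that f(1) F(1) by (intro g(2)) blast+
  moreover have "mdist M u v / L - C \<le> mdist N' (F (f u)) (F (f v)) \<and>
      mdist N' (F (f u)) (F (f v)) \<le> L * mdist M u v + C"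
    if "u \<in> mspace M" "v \<in> mspace M" for u v
    using F(2)[of "f u" "f v"] f that by auto
  moreover have "(\<lambda>u. g (F (f u))) ` mspace M \<subseteq> mspace N"
    using f(1) F(1) g(1) by blast
  ultimately show ?thesis
    unfolding coarsely_embeds_def by (intro exI[of _ "\<lambda>u. g (F (f u))"] exI[of _ C]) simp
qed

text \<open>By reflexivity \<open>(M', a')\<close> lies in its own class, hence in that of
  \<open>(M, a)\<close>.\<close>

lemma isometry_class_eqD:
  assumes "isometry_class M a = isometry_class M' a'" "(M', a') \<in> pointed_proper"
  shows "pointed_isometric (M, a) (M', a')"
  using eq_equiv_class[OF _ equiv_pointed_isometry_rel assms(2), of "(M, a)"] assms(1)
  by (simp add: isometry_class_def pointed_isometry_rel_def)

text \<open>Related classes come with unknown representatives; this carries an embedding between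
  those over to the given spaces.\<close>

lemma coarsely_embeds_isometry_class:
  assumes "isometry_class M a = isometry_class M' a'" "isometry_class N b = isometry_class N' b'"
    "(M', a') \<in> pointed_proper" "(N, b) \<in> pointed_proper" "coarsely_embeds L M' N'"
  shows "coarsely_embeds L M N"
  using coarsely_embeds_isometric[OF assms(5) isometry_class_eqD[OF assms(1,3)]
    isometry_class_eqD[OF assms(2)[symmetric] assms(4)]] .

section \<open>From the two relations to coarse embeddings\<close>

lemma point_set_dist_less_iff:
  "point_set_dist D u A < e \<longleftrightarrow> (\<exists>v\<in>A. ennreal (mdist D u v) < e)"
  by (simp add: point_set_dist_def INF_less_iff)

text \<open>Send each point of \<open>M\<close> to a point of \<open>N\<close> that is near in an
  admissible metric. The infima need not be attained, so near means closer than
  \<open>K + 1\<close>; the triangle inequality then changes distances by at most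
  \<open>2 * (K + 1)\<close>.\<close>

lemma GH_finite_imp_coarsely_embeds:
  assumes "gromov_hausdorff_dist M N < \<infinity>"
  shows "coarsely_embeds 1 M N"
proof -
  obtain D where D: "D \<in> admissible_metrics M N"
    and fin: "hausdorff_dist D (Inl ` mspace M) (Inr ` mspace N) < \<infinity>"
    using assms by (auto simp: gromov_hausdorff_dist_def INF_less_iff)
  obtain K where K: "K \<ge> 0" "hausdorff_dist D (Inl ` mspace M) (Inr ` mspace N) = ennreal K"
    using fin by (cases "hausdorff_dist D (Inl ` mspace M) (Inr ` mspace N)") auto
  have "\<exists>v\<in>mspace N. mdist D (Inl u) (Inr v) < K + 1" if "u \<in> mspace M" for u
  proof -
    have "point_set_dist D (Inl u) (Inr ` mspace N) \<le> ennreal K"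
      using that unfolding K(2)[symmetric] hausdorff_dist_def
      by (intro max.coboundedI1 SUP_upper) auto
    also have "\<dots> < ennreal (K + 1)"
      using K(1) by (simp add: ennreal_less_iff)
    finally show ?thesis
      by (auto simp: point_set_dist_less_iff ennreal_less_iff)
  qed
  then obtain F where F: "\<And>u. u \<in> mspace M \<Longrightarrow> F u \<in> mspace N"
    "\<And>u. u \<in> mspace M \<Longrightarrow> mdist D (Inl u) (Inr (F u)) < K + 1"
    by metis
  have sp: "mspace D = mspace M <+> mspace N"
    and dM: "\<And>u v. u \<in> mspace M \<Longrightarrow> v \<in> mspace M \<Longrightarrow> mdist D (Inl u) (Inl v) = mdist M u v"
    and dN: "\<And>u v. u \<in> mspace N \<Longrightarrow> v \<in> mspace N \<Longrightarrow> mdist D (Inr u) (Inr v) = mdist N u v"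
    using D by (auto simp: admissible_metrics_def)
  have "mdist M u v / 1 - 2 * (K + 1) \<le> mdist N (F u) (F v) \<and>
        mdist N (F u) (F v) \<le> 1 * mdist M u v + 2 * (K + 1)"
    if u: "u \<in> mspace M" and v: "v \<in> mspace M" for u v
  proof -
    have in_D: "Inl u \<in> mspace D" "Inl v \<in> mspace D" "Inr (F u) \<in> mspace D" "Inr (F v) \<in> mspace D"
      using u v F(1) by (auto simp: sp)
    have "mdist D (Inl u) (Inl v) \<le> mdist D (Inl u) (Inr (F u)) + mdist D (Inr (F u)) (Inl v)"
      "mdist D (Inr (F u)) (Inl v) \<le> mdist D (Inr (F u)) (Inr (F v)) + mdist D (Inr (F v)) (Inl v)"
      "mdist D (Inr (F u)) (Inr (F v)) \<le> mdist D (Inr (F u)) (Inl u) + mdist D (Inl u) (Inr (F v))"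
      "mdist D (Inl u) (Inr (F v)) \<le> mdist D (Inl u) (Inl v) + mdist D (Inl v) (Inr (F v))"
      by (intro mdist_triangle in_D)+
    then show ?thesis
      using F(2)[OF u] F(2)[OF v] dM[OF u v] dN[OF F(1)[OF u] F(1)[OF v]]
        mdist_commute[of D "Inr (F v)" "Inl v"] mdist_commute[of D "Inr (F u)" "Inl u"]
      by auto
  qed
  with F(1) show ?thesis unfolding coarsely_embeds_def by blast
qed

text \<open>Move every point to a nearby point \<open>w u\<close> of the net and apply the
  bi-Lipschitz map there. Moving costs at most \<open>2 * (C + 1)\<close> in distance, which the map
  then scales.\<close>

lemma quasi_isometric_imp_coarsely_embeds:
  assumes "quasi_isometric M N"
  obtains L where "L \<ge> 1" "coarsely_embeds L M N"
proof -
  obtain A B \<phi> where AB: "is_net M A" "is_net N B" "bij_betw \<phi> A B" "bi_Lipschitz_on M N A \<phi>"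
    using assms unfolding quasi_isometric_def by blast
  obtain L where L: "L \<ge> 1"
    "\<And>u v. u \<in> A \<Longrightarrow> v \<in> A \<Longrightarrow> inverse L * mdist M u v \<le> mdist N (\<phi> u) (\<phi> v)"
    "\<And>u v. u \<in> A \<Longrightarrow> v \<in> A \<Longrightarrow> mdist N (\<phi> u) (\<phi> v) \<le> L * mdist M u v"
    using AB(4) unfolding bi_Lipschitz_on_def by blast
  obtain C where C: "C \<ge> 0" "\<And>u. u \<in> mspace M \<Longrightarrow> point_set_dist M u A \<le> ennreal C"
    and A: "A \<subseteq> mspace M"
    using AB(1) unfolding is_net_def by blast
  have B: "\<phi> ` A \<subseteq> mspace N"
    using AB(2,3) by (simp add: is_net_def bij_betw_def)
  have "\<exists>w\<in>A. mdist M u w < C + 1" if "u \<in> mspace M" for u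
  proof -
    have "point_set_dist M u A < ennreal (C + 1)"
      using C(2)[OF that] C(1) by (simp add: ennreal_less_iff order.strict_trans1)
    then show ?thesis by (auto simp: point_set_dist_less_iff ennreal_less_iff)
  qed
  then obtain w where w: "\<And>u. u \<in> mspace M \<Longrightarrow> w u \<in> A" "\<And>u. u \<in> mspace M \<Longrightarrow> mdist M u (w u) < C + 1"
    by metis
  have "mdist M u v / L - 2 * L * (C + 1) \<le> mdist N (\<phi> (w u)) (\<phi> (w v)) \<and>
      mdist N (\<phi> (w u)) (\<phi> (w v)) \<le> L * mdist M u v + 2 * L * (C + 1)"
    if u: "u \<in> mspace M" and v: "v \<in> mspace M" for u v
  proof -
    have in_M: "w u \<in> mspace M" "w v \<in> mspace M"
      using u v w(1) A by auto
    have "mdist M u v \<le> mdist M u (w u) + mdist M (w u) v"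
      "mdist M (w u) v \<le> mdist M (w u) (w v) + mdist M (w v) v"
      "mdist M (w u) (w v) \<le> mdist M (w u) u + mdist M u (w v)"
      "mdist M u (w v) \<le> mdist M u v + mdist M v (w v)"
      by (intro mdist_triangle in_M u v)+
    then have le: "mdist M u v - 2 * (C + 1) \<le> mdist M (w u) (w v)"
      "mdist M (w u) (w v) \<le> mdist M u v + 2 * (C + 1)"
      using w(2)[OF u] w(2)[OF v] mdist_commute[of M "w v" v] mdist_commute[of M "w u" u] by auto
    have "mdist N (\<phi> (w u)) (\<phi> (w v)) \<le> L * (mdist M u v + 2 * (C + 1))"
      using L(1) by (intro order_trans[OF L(3)[OF w(1)[OF u] w(1)[OF v]] mult_left_mono[OF le(2)]]) simp
    moreover have "inverse L * (mdist M u v - 2 * (C + 1)) \<le> mdist N (\<phi> (w u)) (\<phi> (w v))"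
      using L(1) by (intro order_trans[OF mult_left_mono[OF le(1)] L(2)[OF w(1)[OF u] w(1)[OF v]]]) simp
    \<comment> \<open>The lower bound loses only this smaller amount, so one additive constant
      serves both bounds.\<close>
    moreover have "inverse L * (2 * (C + 1)) \<le> L * (2 * (C + 1))"
      using order_trans[OF inverse_le_1_iff[THEN iffD2] L(1)] L(1) C(1)
      by (intro mult_right_mono) auto
    ultimately show ?thesis by (simp add: algebra_simps divide_inverse)
  qed
  moreover have "(\<lambda>u. \<phi> (w u)) ` mspace M \<subseteq> mspace N"
    using w(1) B by blast
  ultimately have "coarsely_embeds L M N"
    unfolding coarsely_embeds_def
    by (intro exI[of _ "\<lambda>u. \<phi> (w u)"] exI[of _ "2 * L * (C + 1)"]) simp
  with L(1) that show thesis by blast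
qed


section \<open>Sets of reals\<close>

abbreviation line :: "real set \<Rightarrow> real metric" where
  "line S \<equiv> submetric euclidean_metric S"

text \<open>The sum metric on two parallel copies of the line at distance \<open>e\<close>. A
  positive \<open>e\<close> separates the two copies of a common point, so that this is a
  metric.\<close>

definition thickened_dist :: "real \<Rightarrow> real + real \<Rightarrow> real + real \<Rightarrow> real" where
  "thickened_dist e p q = (case (p, q) of
     (Inl u, Inl v) \<Rightarrow> \<bar>u - v\<bar> | (Inr u, Inr v) \<Rightarrow> \<bar>u - v\<bar>
   | (Inl u, Inr v) \<Rightarrow> \<bar>u - v\<bar> + e | (Inr u, Inl v) \<Rightarrow> \<bar>u - v\<bar> + e)"

lemma admissible_thickened:
  assumes "e > 0"
  obtains D where "D \<in> admissible_metrics (line S) (line T)"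
    "mspace D = S <+> T" "mdist D = thickened_dist e"
proof -
  have "Metric_space (S <+> T) (thickened_dist e)"
    using assms by unfold_locales (auto simp: thickened_dist_def split: sum.splits)
  then have D: "mspace (metric (S <+> T, thickened_dist e)) = S <+> T"
    "mdist (metric (S <+> T, thickened_dist e)) = thickened_dist e"
    by (simp_all add: Metric_space.mspace_metric Metric_space.mdist_metric)
  then have "metric (S <+> T, thickened_dist e) \<in> admissible_metrics (line S) (line T)"
    by (simp add: admissible_metrics_def thickened_dist_def dist_real_def)
  with D that show thesis by blast
qed

lemma point_set_dist_le:
  assumes "v \<in> A" "mdist D u v \<le> e"
  shows "point_set_dist D u A \<le> ennreal e"
  unfolding point_set_dist_def using assms by (auto intro: INF_lower2 ennreal_leI)

lemma line_GH_finite: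
  assumes "\<And>u. u \<in> S \<Longrightarrow> \<exists>v\<in>T. \<bar>u - v\<bar> \<le> K" "\<And>v. v \<in> T \<Longrightarrow> \<exists>u\<in>S. \<bar>u - v\<bar> \<le> K"
  shows "gromov_hausdorff_dist (line S) (line T) < \<infinity>"
proof -
  obtain D where D: "D \<in> admissible_metrics (line S) (line T)"
    "mspace D = S <+> T" "mdist D = thickened_dist 1"
    by (rule admissible_thickened[of 1]) auto
  have "point_set_dist D (Inl u) (Inr ` T) \<le> ennreal (K + 1)" if u: "u \<in> S" for u
  proof -
    obtain v where "v \<in> T" "\<bar>u - v\<bar> \<le> K" using assms(1)[OF u] by blast
    then show ?thesis by (intro point_set_dist_le[of "Inr v"]) (auto simp: D thickened_dist_def)
  qed
  moreover have "point_set_dist D (Inr v) (Inl ` S) \<le> ennreal (K + 1)" if v: "v \<in> T" for v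
  proof -
    obtain u where "u \<in> S" "\<bar>u - v\<bar> \<le> K" using assms(2)[OF v] by blast
    then show ?thesis by (intro point_set_dist_le[of "Inl u"]) (auto simp: D thickened_dist_def)
  qed
  ultimately have "hausdorff_dist D (Inl ` S) (Inr ` T) \<le> ennreal (K + 1)"
    unfolding hausdorff_dist_def by (auto intro!: SUP_least)
  also have "\<dots> < \<infinity>" by simp
  finally show ?thesis
    unfolding gromov_hausdorff_dist_def INF_less_iff using D(1) by auto
qed

text \<open>Each point within the ball has its twin in the other copy, at distance
  \<open>r / 2\<close> in the thickened metric. Half of \<open>r\<close> leaves room for the strict
  inequality in the entourage.\<close>

lemma line_entourage:
  assumes "proper_metric (line S)" "proper_metric (line T)" "b \<in> S" "b \<in> T" "r > 0"
    and agree: "S \<inter> ball b R = T \<inter> ball b R"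
  shows "(isometry_class (line S) b, isometry_class (line T) b) \<in> gromov_entourage R r"
proof -
  have r2: "r / 2 > 0" using assms by simp
  obtain D where D: "D \<in> admissible_metrics (line S) (line T)"
    "mspace D = S <+> T" "mdist D = thickened_dist (r / 2)"
    by (rule admissible_thickened[OF r2])
  have "point_set_dist D (Inl u) (Inr ` T) \<le> ennreal (r / 2)" if "u \<in> S" "\<bar>b - u\<bar> < R" for u
  proof -
    have "u \<in> T" using that agree by (auto simp: dist_real_def set_eq_iff)
    then show ?thesis by (intro point_set_dist_le[of "Inr u"]) (auto simp: D thickened_dist_def)
  qed
  moreover have "point_set_dist D (Inr v) (Inl ` S) \<le> ennreal (r / 2)" if "v \<in> T" "\<bar>b - v\<bar> < R" for v
  proof -
    have "v \<in> S" using that agree by (auto simp: dist_real_def set_eq_iff)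
    then show ?thesis by (intro point_set_dist_le[of "Inl v"]) (auto simp: D thickened_dist_def)
  qed
  ultimately have "max (ennreal (mdist D (Inl b) (Inr b)))
      (local_hausdorff_dist D R (Inl ` S) (Inl b) (Inr ` T) (Inr b)) \<le> ennreal (r / 2)"
    unfolding local_hausdorff_dist_def
    by (auto intro!: SUP_least simp: D thickened_dist_def)
  also have "\<dots> < ennreal r" using assms by (simp add: ennreal_less_iff)
  finally show ?thesis
    unfolding gromov_entourage_def mem_Collect_eq using assms(1-4) D(1)
    by (intro exI[of _ "line S"] exI[of _ "line T"] exI[of _ b]) (simp add: pointed_proper_def, blast)
qed

text \<open>A ball lies below \<open>u + r\<close>, so it is finite. Finite sets are closed in a T1
  space, so the ball is its own closure, and it is compact.\<close>

lemma proper_metric_line: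
  assumes "\<And>r. finite (S \<inter> {..r})" "\<And>u. u \<in> S \<Longrightarrow> u \<ge> 0"
  shows "proper_metric (line S)"
  unfolding proper_metric_def
proof (intro ballI allI)
  fix u r assume u: "u \<in> mspace (line S)"
  let ?B = "mball_of (line S) u r"
  have "?B \<subseteq> S \<inter> {..u + r}" by (auto simp: dist_real_def)
  then have fin: "finite ?B" using assms(1) finite_subset by blast
  have top: "?B \<subseteq> topspace (mtopology_of (line S))" by auto
  have "t1_space (mtopology_of (line S))"
    unfolding mtopology_of_submetric mtopology_of_euclidean
    by (simp add: Hausdorff_imp_t1_space Hausdorff_space_subtopology)
  then have "closedin (mtopology_of (line S)) ?B"
    using fin top t1_space_closedin_finite by blast
  then have "mtopology_of (line S) closure_of ?B = ?B" by (rule closure_of_closedin)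
  then show "compactin (mtopology_of (line S)) (mtopology_of (line S) closure_of ?B)"
    using finite_imp_compactin[OF top fin] by simp
qed

section \<open>Coarse embeddings from related isometry classes\<close>

lemma GH_relationD:
  assumes "(N, b) \<in> pointed_proper"
    "(isometry_class M a, isometry_class N b) \<in> GH_relation"
  shows "coarsely_embeds 1 M N"
proof -
  obtain M' a' N' b' where "isometry_class M a = isometry_class M' a'"
    "isometry_class N b = isometry_class N' b'" "(M', a') \<in> pointed_proper"
    "gromov_hausdorff_dist M' N' < \<infinity>"
    using assms(2) unfolding GH_relation_def by blast
  then show ?thesis
    using GH_finite_imp_coarsely_embeds coarsely_embeds_isometry_class assms(1) by blast
qed

lemma QI_relationD:
  assumes "(N, b) \<in> pointed_proper"
    "(isometry_class M a, isometry_class N b) \<in> QI_relation"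
  obtains L where "L \<ge> 1" "coarsely_embeds L M N"
proof -
  obtain M' a' N' b' where eq: "isometry_class M a = isometry_class M' a'"
    "isometry_class N b = isometry_class N' b'" "(M', a') \<in> pointed_proper"
    and "quasi_isometric M' N'"
    using assms(2) unfolding QI_relation_def by blast
  then obtain L where L: "L \<ge> 1" "coarsely_embeds L M' N'"
    using quasi_isometric_imp_coarsely_embeds by blast
  show thesis
    by (rule that[OF L(1) coarsely_embeds_isometry_class[OF eq assms(1) L(2)]])
qed


section \<open>Coding a sequence by the gaps of a sparse set of reals\<close>

text \<open>The square in the exponent makes the ratios \<open>2 ^ (2 * n + 1)\<close> of
  consecutive anchors unbounded, so they eventually exceed any fixed distortion factor.\<close>

definition anchor :: "nat \<Rightarrow> real" where
  "anchor n = 2 ^ n\<^sup>2"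

section \<open>Growth of the anchors\<close>

lemma anchor_ge_1: "anchor n \<ge> 1"
  by (simp add: anchor_def)

lemma anchor_mono: "n \<le> m \<Longrightarrow> anchor n \<le> anchor m"
  by (simp add: anchor_def power_increasing)

lemma anchor_ge: "anchor n \<ge> real n"
proof -
  have "n \<le> n\<^sup>2" by (simp add: power2_eq_square)
  also have "\<dots> \<le> 2 ^ n\<^sup>2" by (rule less_imp_le[OF less_exp])
  finally have "real n \<le> real (2 ^ n\<^sup>2)" by (rule of_nat_mono)
  then show ?thesis by (simp add: anchor_def)
qed

lemma anchor_Suc: "anchor (Suc n) \<ge> real n * anchor n"
proof -
  have "real n \<le> 2 ^ n" by (rule less_imp_le[OF of_nat_less_two_power])
  also have "\<dots> \<le> 2 ^ (2 * n + 1)" by (rule power_increasing) auto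
  finally have "real n * anchor n \<le> 2 ^ (2 * n + 1) * anchor n"
    using anchor_ge_1[of n] by (intro mult_right_mono) auto
  also have "\<dots> = anchor (Suc n)"
    unfolding anchor_def power_add[symmetric] by (simp add: power2_eq_square)
  finally show ?thesis .
qed

text \<open>Level \<open>n\<close> of a code will lie between \<open>anchor n\<close> and
  \<open>2 * anchor n\<close>; the factor 4 keeps it below half of any later anchor.\<close>

lemma anchor_less:
  assumes "2 \<le> n" "n < m"
  shows "4 * anchor n \<le> anchor m"
proof -
  have "n\<^sup>2 + 2 \<le> (Suc n)\<^sup>2" using assms(1) by (simp add: power2_eq_square)
  also have "\<dots> \<le> m\<^sup>2" using assms(2) by (intro power_mono) auto
  finally have "(2::real) ^ (n\<^sup>2 + 2) \<le> 2 ^ m\<^sup>2" by (rule power_increasing) simp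
  then show ?thesis by (simp add: anchor_def)
qed

text \<open>Anchors are at least 1, so \<open>c\<close> is absorbed into the factor, and a fixed
  factor loses against \<open>real n\<close> in \<open>anchor_Suc\<close>. Thus no affine distortion
  reaches from a high level to the next.\<close>

lemma eventually_anchor_Suc_gt: "\<forall>\<^sub>F n in sequentially. K * anchor n + c < anchor (Suc n)"
proof -
  obtain N :: nat where N: "K + \<bar>c\<bar> < real N" using reals_Archimedean2 by blast
  have "K * anchor n + c < anchor (Suc n)" if "n \<ge> N" for n
  proof -
    have "c \<le> \<bar>c\<bar> * anchor n"
      using mult_left_mono[OF anchor_ge_1[of n], of "\<bar>c\<bar>"] by simp
    then have "K * anchor n + c \<le> (K + \<bar>c\<bar>) * anchor n" by (simp add: algebra_simps)
    also have "\<dots> < real n * anchor n"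
      using N that anchor_ge_1[of n] by (intro mult_strict_right_mono) auto
    also note anchor_Suc
    finally show ?thesis .
  qed
  then show ?thesis unfolding eventually_sequentially by blast
qed

lemma Ksigma_space_memD:
  assumes "x \<in> topspace Ksigma_space" "2 \<le> n"
  shows "1 \<le> x n" "x n \<le> n"
  using assms by (auto simp: Ksigma_space_def PiE_def Pi_def)

text \<open>The two reductions differ only in their gaps. The lower bound makes the gaps exceed
  every additive error, and the upper bound confines level \<open>n\<close> to the interval from
  \<open>anchor n\<close> to \<open>2 * anchor n\<close>.\<close>

locale gap_function =
  fixes gap :: "nat \<Rightarrow> nat \<Rightarrow> real"
  assumes gap_ge: "\<And>n k. 2 \<le> n \<Longrightarrow> 1 \<le> k \<Longrightarrow> k \<le> n \<Longrightarrow> real n \<le> gap n k"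
    and gap_le: "\<And>n k. 2 \<le> n \<Longrightarrow> 1 \<le> k \<Longrightarrow> k \<le> n \<Longrightarrow> gap n k \<le> anchor n"
begin

definition point :: "(nat \<Rightarrow> nat) \<Rightarrow> nat \<Rightarrow> bool \<Rightarrow> real" where
  "point x n i = anchor n + (if i then gap n (x n) else 0)"

definition points :: "(nat \<Rightarrow> nat) \<Rightarrow> real set" where
  "points x = (\<lambda>(n, i). point x n i) ` ({2..} \<times> UNIV)"

text \<open>The base point is \<open>point x 2 False\<close> for every \<open>x\<close>, so all
  codes share it and can be compared near it.\<close>

definition code :: "(nat \<Rightarrow> nat) \<Rightarrow> (real metric \<times> real) set" where
  "code x = isometry_class (line (points x)) (anchor 2)"

lemma pointsI: "2 \<le> n \<Longrightarrow> point x n i \<in> points x"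
  by (force simp: points_def)

lemma pointsE:
  assumes "u \<in> points x"
  obtains n i where "2 \<le> n" "u = point x n i"
  using assms by (auto simp: points_def)

section \<open>Metric structure of a single code\<close>

context
  fixes x assumes x: "x \<in> topspace Ksigma_space"
begin

lemma point_bounds:
  assumes "2 \<le> n"
  shows "anchor n \<le> point x n i" "point x n i \<le> 2 * anchor n"
  using gap_ge[OF assms Ksigma_space_memD[OF x assms]] gap_le[OF assms Ksigma_space_memD[OF x assms]]
    anchor_ge_1[of n] by (auto simp: point_def)

lemma point_same_level:
  assumes "2 \<le> n" "i \<noteq> j"
  shows "\<bar>point x n i - point x n j\<bar> = gap n (x n)"
  using assms(2) gap_ge[OF assms(1) Ksigma_space_memD[OF x assms(1)]]
  by (auto simp: point_def)

text \<open>Level \<open>n\<close> ends at or below \<open>anchor m / 2\<close>, so distances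
  between levels are the larger anchor up to a factor 2, whatever the gaps are.\<close>

lemma point_across:
  assumes "2 \<le> n" "n < m"
  shows "anchor m / 2 \<le> \<bar>point x n i - point x m j\<bar>" "\<bar>point x n i - point x m j\<bar> \<le> 2 * anchor m"
  using point_bounds[of n i] point_bounds[of m j] anchor_less[OF assms] assms anchor_ge_1[of n]
  by auto

text \<open>Distinct indices give points at positive distance. This allows maps between codes to be
  defined through indices.\<close>

lemma inj_point: "inj_on (\<lambda>(n, i). point x n i) ({2..} \<times> UNIV)"
proof -
  have level: "n = m" if "2 \<le> n" "2 \<le> m" "point x n i = point x m j" for n m i j
  proof (rule ccontr)
    assume "n \<noteq> m"
    then show False using that point_across(1)[of n m i j] point_across(1)[of m n j i]
      anchor_ge_1[of n] anchor_ge_1[of m] by (cases "n < m") auto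
  qed
  have "i = j" if "2 \<le> n" "point x n i = point x n j" for n i j
    using point_same_level[OF that(1), of i j] that
      gap_ge[OF that(1) Ksigma_space_memD[OF x that(1)]] by (cases "i = j") auto
  then show ?thesis by (intro inj_onI) (auto dest: level)
qed

text \<open>Only finitely many levels meet a bounded region. Both properness and continuity rest on
  this.\<close>

lemma point_level_le:
  assumes "2 \<le> n" "point x n i \<le> real N"
  shows "n \<le> N"
  using point_bounds(1)[OF assms(1), of i] anchor_ge[of n] assms(2) by linarith

lemma pointed_proper_points: "(line (points x), anchor 2) \<in> pointed_proper"
proof -
  have "finite (points x \<inter> {..r})" for r
  proof -
    obtain N where N: "r \<le> real N" using real_arch_simple by blast
    have "points x \<inter> {..r} \<subseteq> (\<lambda>(n, i). point x n i) ` ({2..N} \<times> UNIV)"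
    proof
      fix u assume "u \<in> points x \<inter> {..r}"
      then obtain n i where n: "2 \<le> n" "u = point x n i" "u \<le> r" by (auto elim: pointsE)
      then have "n \<le> N" using N by (intro point_level_le[of n i]) auto
      then show "u \<in> (\<lambda>(n, i). point x n i) ` ({2..N} \<times> UNIV)" using n by force
    qed
    then show ?thesis by (rule finite_subset) auto
  qed
  moreover have "u \<ge> 0" if u: "u \<in> points x" for u
  proof -
    obtain n i where "2 \<le> n" "u = point x n i" using u by (rule pointsE)
    then show ?thesis using point_bounds(1)[of n i] anchor_ge_1[of n] by simp
  qed
  ultimately have "proper_metric (line (points x))" by (rule proper_metric_line)
  then show ?thesis
    using pointsI[of 2 x False] by (simp add: pointed_proper_def point_def)
qed

end

text \<open>Fixing finitely many terms of \<open>x\<close> fixes the code in a ball around the base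
  point, and codes that agree there are close by \<open>line_entourage\<close>.\<close>

lemma continuous_code: "continuous_map Ksigma_space gromov_topology code"
  unfolding continuous_map_def
proof (intro conjI allI impI)
  show "code \<in> topspace Ksigma_space \<rightarrow> topspace gromov_topology"
    unfolding topspace_gromov_topology gromov_space_eq code_def
    using pointed_proper_points by blast
next
  fix U assume U: "openin gromov_topology U"
  show "openin Ksigma_space {x \<in> topspace Ksigma_space. code x \<in> U}"
  proof (subst openin_subopen, intro ballI)
    fix x assume "x \<in> {x \<in> topspace Ksigma_space. code x \<in> U}"
    then have x: "x \<in> topspace Ksigma_space" and "code x \<in> U" by auto
    then obtain R r where R: "r > 0" "gromov_entourage R r `` {code x} \<subseteq> U"
      using U unfolding openin_gromov_topology by blast
    \<comment> \<open>Points of the ball of radius \<open>R\<close> around the base point are below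
      \<open>anchor 2 + R\<close>, hence on levels up to \<open>N\<close>.\<close>
    obtain N where N: "anchor 2 + R \<le> real N" using real_arch_simple by blast
    define V where "V = PiE {2..} (\<lambda>n. if n \<le> N then {x n} else {1..n})"
    have "openin Ksigma_space V"
      unfolding Ksigma_space_def V_def openin_PiE_gen
      using Ksigma_space_memD[OF x]
      by (auto intro!: disjI2 finite_subset[of _ "{..N}"])
    moreover have "x \<in> V"
      using x by (auto simp: V_def Ksigma_space_def PiE_def Pi_def)
    moreover have "code y \<in> U \<and> y \<in> topspace Ksigma_space" if y: "y \<in> V" for y
    proof
      have eq: "y n = x n" if "2 \<le> n" "n \<le> N" for n
        using PiE_mem[OF y[unfolded V_def], of n] that by simp
      show y': "y \<in> topspace Ksigma_space"
        using y Ksigma_space_memD[OF x] unfolding V_def Ksigma_space_def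
        by (auto simp: PiE_def Pi_def split: if_splits)
      \<comment> \<open>Stated for arbitrary \<open>z\<close> and \<open>w\<close> because both
        inclusions between \<open>x\<close> and \<open>y\<close> are needed.\<close>
      have sub: "points z \<inter> ball (anchor 2) R \<subseteq> points w"
        if z: "z \<in> topspace Ksigma_space" and w: "\<And>n. 2 \<le> n \<Longrightarrow> n \<le> N \<Longrightarrow> z n = w n" for z w
      proof
        fix u assume "u \<in> points z \<inter> ball (anchor 2) R"
        then obtain n i where n: "2 \<le> n" "u = point z n i" "dist (anchor 2) u < R"
          by (auto elim: pointsE)
        then have "n \<le> N"
          using N by (intro point_level_le[OF z, of n i]) (auto simp: dist_real_def)
        then have "u = point w n i" using n w by (simp add: point_def)
        then show "u \<in> points w" using n pointsI by simp
      qed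
      have "points x \<inter> ball (anchor 2) R = points y \<inter> ball (anchor 2) R"
        using sub[OF x, of y] sub[OF y', of x] eq by auto
      then have "(code x, code y) \<in> gromov_entourage R r"
        unfolding code_def
        using pointed_proper_points[OF x] pointed_proper_points[OF y'] R(1)
        by (intro line_entourage) (auto simp: pointed_proper_def)
      then show "code y \<in> U" using R(2) by blast
    qed
    ultimately show "\<exists>T. openin Ksigma_space T \<and> x \<in> T \<and>
        T \<subseteq> {x \<in> topspace Ksigma_space. code x \<in> U}"
      by blast
  qed
qed

text \<open>
  The anchors grow so fast that a coarse embedding preserves all sufficiently high levels, and the
  gaps tend to infinity, so it does not identify the two points of such a level.
\<close>

lemma coarsely_embeds_imp_gap:
  assumes x: "x \<in> topspace Ksigma_space" and y: "y \<in> topspace Ksigma_space" and L: "L \<ge> 1"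
    and "coarsely_embeds L (line (points x)) (line (points y))"
  obtains C where "\<forall>\<^sub>F n in sequentially.
    gap n (x n) / L - C \<le> gap n (y n) \<and> gap n (y n) \<le> L * gap n (x n) + C"
proof -
  obtain F C where F: "\<And>u. u \<in> points x \<Longrightarrow> F u \<in> points y"
    and FC: "\<And>u v. u \<in> points x \<Longrightarrow> v \<in> points x \<Longrightarrow>
      \<bar>u - v\<bar> / L - C \<le> \<bar>F u - F v\<bar> \<and> \<bar>F u - F v\<bar> \<le> L * \<bar>u - v\<bar> + C"
    using assms(4) unfolding coarsely_embeds_def
    by (simp add: dist_real_def image_subset_iff) blast
  define b where "b = anchor 2"
  have b: "b \<in> points x" "b \<ge> 1"
    using pointsI[of 2 x False] anchor_ge_1 by (simp_all add: point_def b_def)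
  have pos: "v \<ge> 1" if v: "v \<in> points y" for v
  proof -
    obtain n i where "2 \<le> n" "v = point y n i" using v by (rule pointsE)
    then show ?thesis using point_bounds(1)[OF y, of n i] anchor_ge_1[of n] by simp
  qed
  have C: "C \<ge> 0" using FC[OF b(1) b(1)] by simp
  \<comment> \<open>Heights are measured by comparison with the base point \<open>b\<close>;
    \<open>c\<close> collects everything that this comparison adds.\<close>
  define c where "c = F b + C + b"
  have c: "c \<ge> 0" using pos[OF F[OF b(1)]] C b by (simp add: c_def)
  have "c \<le> L * c" using mult_right_mono[OF L c] by simp
  have F_le: "F (point x n i) \<le> 2 * L * anchor n + c"
    and F_ge: "anchor n \<le> L * F (point x n i) + L * c" if n: "2 \<le> n" for n i
  proof -
    let ?u = "point x n i"
    have u: "?u \<in> points x" "anchor n \<le> ?u" "?u \<le> 2 * anchor n" "b \<le> ?u"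
      using n point_bounds[OF x n, of i] anchor_mono[OF n] by (auto simp: pointsI b_def)
    have "L * \<bar>?u - b\<bar> \<le> L * (2 * anchor n)"
      using u b L by (intro mult_left_mono) auto
    then show "F ?u \<le> 2 * L * anchor n + c"
      using FC[OF u(1) b(1)] b unfolding c_def by linarith
    have "\<bar>?u - b\<bar> / L \<le> F ?u + F b + C"
      using FC[OF u(1) b(1)] pos[OF F[OF b(1)]] pos[OF F[OF u(1)]] by linarith
    then have "?u - b \<le> L * (F ?u + F b + C)"
      using u(4) L by (simp add: field_simps)
    moreover have "b \<le> L * b" using mult_right_mono[OF L, of b] b by simp
    ultimately show "anchor n \<le> L * F ?u + L * c"
      using u(2) by (simp add: c_def algebra_simps)
  qed
  \<comment> \<open>One threshold excludes both a rise in level, through \<open>F_le\<close> and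
    \<open>c \<le> L * c\<close>, and a drop, through \<open>F_ge\<close>.\<close>
  obtain N where N: "\<And>n. n \<ge> N \<Longrightarrow> 2 * L * anchor n + L * c < anchor (Suc n)"
    using eventually_anchor_Suc_gt unfolding eventually_sequentially by metis
  \<comment> \<open>\<open>Suc N\<close> is used because the case of a drop applies the threshold to
    the predecessor of \<open>n\<close>.\<close>
  have level: "\<exists>j. F (point x n i) = point y n j" if n: "2 \<le> n" "Suc N \<le> n" for n i
  proof -
    obtain m j where m: "2 \<le> m" "F (point x n i) = point y m j"
      using F[OF pointsI[OF n(1)]] by (rule pointsE)
    note bounds = point_bounds[OF y m(1), of j]
    have "\<not> n < m"
    proof
      assume "n < m"
      then have "anchor (Suc n) \<le> anchor m" by (intro anchor_mono) simp
      then show False using F_le[OF n(1), of i] N[of n] n(2) m bounds \<open>c \<le> L * c\<close> by linarith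
    qed
    moreover have "\<not> m < n"
    proof
      assume "m < n"
      obtain k where k: "n = Suc k" using n by (cases n) auto
      have "anchor m \<le> anchor k" using \<open>m < n\<close> k by (intro anchor_mono) simp
      then have "L * F (point x n i) \<le> L * (2 * anchor k)"
        using bounds m L by (intro mult_left_mono) auto
      then show False using F_ge[OF n(1), of i] N[of k] n(2) k by simp
    qed
    ultimately show ?thesis using m(2) by (metis linorder_neqE_nat)
  qed
  \<comment> \<open>From here on the gap is larger than \<open>L * C\<close>, so the lower bound
    \<open>gap n (x n) / L - C\<close> on the distance of the images is positive.\<close>
  obtain N' :: nat where N': "L * C < real N'" using reals_Archimedean2 by blast
  have "gap n (x n) / L - C \<le> gap n (y n) \<and> gap n (y n) \<le> L * gap n (x n) + C"
    if "n \<ge> max 2 (max (Suc N) N')" for n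
  proof -
    have n: "2 \<le> n" "Suc N \<le> n" "N' \<le> n" using that by auto
    obtain i j where ij: "F (point x n True) = point y n i" "F (point x n False) = point y n j"
      using level[OF n(1,2)] by metis
    have est: "gap n (x n) / L - C \<le> \<bar>point y n i - point y n j\<bar> \<and>
        \<bar>point y n i - point y n j\<bar> \<le> L * gap n (x n) + C"
      using FC[OF pointsI[OF n(1)] pointsI[OF n(1)], of True False]
        point_same_level[OF x n(1), of True False] by (simp add: ij)
    have "L * C < gap n (x n)"
      using N' n(3) gap_ge[OF n(1) Ksigma_space_memD[OF x n(1)]] by linarith
    then have "C < gap n (x n) / L" using L by (simp add: field_simps)
    \<comment> \<open>The images may appear in either order; \<open>point_same_level\<close> gives
      the same gap for both.\<close>
    then have "i \<noteq> j" using est by (intro notI) simp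
    then show ?thesis using est point_same_level[OF y n(1)] by simp
  qed
  then show thesis using that unfolding eventually_sequentially by blast
qed

section \<open>From comparable gaps to related codes\<close>

lemma GH_finite_points:
  assumes "\<And>n. 2 \<le> n \<Longrightarrow> \<bar>gap n (x n) - gap n (y n)\<bar> \<le> K"
  shows "gromov_hausdorff_dist (line (points x)) (line (points y)) < \<infinity>"
proof (rule line_GH_finite)
  \<comment> \<open>Anchors are matched with themselves, where the bound by \<open>K\<close> amounts
    to its nonnegativity.\<close>
  have "K \<ge> 0" using assms[of 2] by simp
  then have le: "\<bar>point x n i - point y n i\<bar> \<le> K" if "2 \<le> n" for n i
    using assms[OF that] by (simp add: point_def)
  show "\<exists>v\<in>points y. \<bar>u - v\<bar> \<le> K" if "u \<in> points x" for u
    using that le pointsI by (metis pointsE)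
  show "\<exists>u\<in>points x. \<bar>u - v\<bar> \<le> K" if "v \<in> points y" for v
    using that le pointsI by (metis pointsE)
qed

text \<open>Across levels, \<open>point_across\<close> puts the distances in both codes between
  \<open>anchor m / 2\<close> and \<open>2 * anchor m\<close>, so their ratio is at most 4; hence
  the condition \<open>L \<ge> 4\<close>. Within a level the hypothesis on the gaps applies.\<close>

lemma point_stretch:
  assumes x: "x \<in> topspace Ksigma_space" and y: "y \<in> topspace Ksigma_space" and L: "L \<ge> 4"
    and gap: "\<And>n. 2 \<le> n \<Longrightarrow> gap n (y n) \<le> L * gap n (x n)"
    and nm: "2 \<le> n" "2 \<le> m"
  shows "\<bar>point y n i - point y m j\<bar> \<le> L * \<bar>point x n i - point x m j\<bar>"
proof -
  have across: "\<bar>point y n i - point y m j\<bar> \<le> L * \<bar>point x n i - point x m j\<bar>"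
    if nm: "2 \<le> n" "n < m" for n m i j
  proof -
    have "\<bar>point y n i - point y m j\<bar> \<le> 4 * (anchor m / 2)"
      using point_across(2)[OF y nm] by simp
    also have "\<dots> \<le> L * \<bar>point x n i - point x m j\<bar>"
      using L point_across(1)[OF x nm] anchor_ge_1[of m] by (intro mult_mono) auto
    finally show ?thesis .
  qed
  consider "n < m" | "m < n" | "n = m" "i = j" | "n = m" "i \<noteq> j" by fastforce
  then show ?thesis
  proof cases
    case 1
    then show ?thesis using across nm by blast
  next
    case 2
    then show ?thesis using across[of m n j i] nm by (simp add: abs_minus_commute)
  next
    case 3
    then show ?thesis by simp
  next
    case 4
    then show ?thesis using gap nm point_same_level[OF x] point_same_level[OF y] by simp
  qed
qed

text \<open>The map preserves indices and takes the whole codes as nets.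
  \<open>point_stretch\<close> in both directions yields the two Lipschitz bounds.\<close>

lemma quasi_isometric_points:
  assumes x: "x \<in> topspace Ksigma_space" and y: "y \<in> topspace Ksigma_space" and L: "L \<ge> 4"
    and gap: "\<And>n. 2 \<le> n \<Longrightarrow> gap n (y n) \<le> L * gap n (x n)"
      "\<And>n. 2 \<le> n \<Longrightarrow> gap n (x n) \<le> L * gap n (y n)"
  shows "quasi_isometric (line (points x)) (line (points y))"
proof -
  let ?I = "{2..} \<times> (UNIV :: bool set)"
  define \<phi> where "\<phi> = (\<lambda>(n, i). point y n i) \<circ> inv_into ?I (\<lambda>(n, i). point x n i)"
  have \<phi>: "\<phi> (point x n i) = point y n i" if "2 \<le> n" for n i
    using inv_into_f_f[OF inj_point[OF x], of "(n, i)"] that by (simp add: \<phi>_def)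
  have "bij_betw \<phi> (points x) (points y)"
    unfolding \<phi>_def points_def
    by (intro bij_betw_trans[OF bij_betw_inv_into] inj_on_imp_bij_betw inj_point x y)
  moreover have "bi_Lipschitz_on (line (points x)) (line (points y)) (points x) \<phi>"
    unfolding bi_Lipschitz_on_def
  proof (intro exI[of _ L] conjI ballI)
    show "L \<ge> 1" using L by simp
    fix u v assume "u \<in> points x" "v \<in> points x"
    then obtain n i m j where uv: "2 \<le> n" "u = point x n i" "2 \<le> m" "v = point x m j"
      by (metis pointsE)
    show "mdist (line (points y)) (\<phi> u) (\<phi> v) \<le> L * mdist (line (points x)) u v"
      using point_stretch[OF x y L gap(1) uv(1,3)] by (simp add: uv \<phi> dist_real_def)
    have "\<bar>point x n i - point x m j\<bar> \<le> L * \<bar>point y n i - point y m j\<bar>"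
      using point_stretch[OF y x L gap(2) uv(1,3)] .
    then show "inverse L * mdist (line (points x)) u v \<le> mdist (line (points y)) (\<phi> u) (\<phi> v)"
      using L by (simp add: uv \<phi> dist_real_def field_simps)
  qed
  moreover have "is_net (line S) S" for S
    unfolding is_net_def by (auto intro!: exI[of _ 0] point_set_dist_le[where e = 0, simplified])
  ultimately show ?thesis unfolding quasi_isometric_def by blast
qed

end


section \<open>The two reductions\<close>

lemma Ksigma_relation_iff:
  assumes "x \<in> topspace Ksigma_space" "y \<in> topspace Ksigma_space"
  shows "(x, y) \<in> Ksigma_relation \<longleftrightarrow> (\<exists>K. \<forall>n\<ge>2. \<bar>real (x n) - real (y n)\<bar> \<le> K)"
proof
  assume "(x, y) \<in> Ksigma_relation"
  then obtain K where K: "K \<ge> 0" "(SUP n\<in>{2..}. ennreal \<bar>real (x n) - real (y n)\<bar>) = ennreal K"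
    unfolding Ksigma_relation_def
    by (cases "SUP n\<in>{2..}. ennreal \<bar>real (x n) - real (y n)\<bar>") auto
  have "\<bar>real (x n) - real (y n)\<bar> \<le> K" if "n \<ge> 2" for n
  proof -
    have "ennreal \<bar>real (x n) - real (y n)\<bar> \<le> ennreal K"
      unfolding K(2)[symmetric] using that by (intro SUP_upper) simp
    then show ?thesis using K(1) by simp
  qed
  then show "\<exists>K. \<forall>n\<ge>2. \<bar>real (x n) - real (y n)\<bar> \<le> K" by blast
next
  assume "\<exists>K. \<forall>n\<ge>2. \<bar>real (x n) - real (y n)\<bar> \<le> K"
  then obtain K where "\<And>n. n \<ge> 2 \<Longrightarrow> \<bar>real (x n) - real (y n)\<bar> \<le> K" by blast
  then have "(SUP n\<in>{2..}. ennreal \<bar>real (x n) - real (y n)\<bar>) \<le> ennreal K"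
    by (intro SUP_least ennreal_leI) simp
  also have "\<dots> < \<infinity>" by simp
  finally show "(x, y) \<in> Ksigma_relation" using assms by (simp add: Ksigma_relation_def)
qed

text \<open>The terms are at most \<open>n\<close>, so the differences at indices below
  \<open>N\<close> are bounded by \<open>N\<close>.\<close>

lemma eventually_imp_Ksigma_relation:
  assumes x: "x \<in> topspace Ksigma_space" and y: "y \<in> topspace Ksigma_space"
    and "\<forall>\<^sub>F n in sequentially. \<bar>real (x n) - real (y n)\<bar> \<le> K"
  shows "(x, y) \<in> Ksigma_relation"
proof -
  obtain N where N: "\<And>n. n \<ge> N \<Longrightarrow> \<bar>real (x n) - real (y n)\<bar> \<le> K"
    using assms(3) unfolding eventually_sequentially by blast
  have "\<bar>real (x n) - real (y n)\<bar> \<le> max K (real N)" if n: "n \<ge> 2" for n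
    using N[of n] Ksigma_space_memD[OF x n] Ksigma_space_memD[OF y n] by (cases "n \<ge> N") auto
  then show ?thesis unfolding Ksigma_relation_iff[OF x y] by blast
qed

text \<open>The upper bound is \<open>n + k \<le> 2 * n \<le> n\<^sup>2\<close>, which uses that
  levels start at 2.\<close>

lemma gap_function_power: "gap_function (\<lambda>n k. 2 ^ (n + k))"
proof
  fix n k :: nat assume n: "2 \<le> n" "1 \<le> k" "k \<le> n"
  have "real n \<le> 2 ^ n" by (rule less_imp_le[OF of_nat_less_two_power])
  also have "\<dots> \<le> 2 ^ (n + k)" by (rule power_increasing) auto
  finally show "real n \<le> 2 ^ (n + k)" .
  have "n + k \<le> n\<^sup>2" using mult_le_mono1[OF n(1), of n] n(3) unfolding power2_eq_square by linarith
  then show "2 ^ (n + k) \<le> anchor n" by (simp add: anchor_def power_increasing)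
qed

lemma gap_function_add: "gap_function (\<lambda>n k. real (n + k))"
proof
  fix n k :: nat assume n: "2 \<le> n" "1 \<le> k" "k \<le> n"
  show "real n \<le> real (n + k)" by simp
  have "real (n + k) \<le> 2 ^ (n + k)" by (rule less_imp_le[OF of_nat_less_two_power])
  also have "\<dots> \<le> anchor n" by (rule gap_function.gap_le[OF gap_function_power n])
  finally show "real (n + k) \<le> anchor n" .
qed

text \<open>Here coarse embeddings have factor 1, so gaps are compared up to an additive constant,
  and the summand \<open>n\<close> cancels.\<close>

lemma Ksigma_reducible_GH:
  "continuously_reducible Ksigma_space Ksigma_relation gromov_topology GH_relation"
proof -
  interpret gap_function "\<lambda>n k. real (n + k)" by (rule gap_function_add)
  have "(x, y) \<in> Ksigma_relation \<longleftrightarrow> (code x, code y) \<in> GH_relation"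
    if x: "x \<in> topspace Ksigma_space" and y: "y \<in> topspace Ksigma_space" for x y
  proof
    assume "(x, y) \<in> Ksigma_relation"
    then obtain K where "\<And>n. n \<ge> 2 \<Longrightarrow> \<bar>real (x n) - real (y n)\<bar> \<le> K"
      unfolding Ksigma_relation_iff[OF x y] by blast
    then have "gromov_hausdorff_dist (line (points x)) (line (points y)) < \<infinity>"
      by (intro GH_finite_points[of _ _ K]) simp
    then show "(code x, code y) \<in> GH_relation"
      unfolding GH_relation_def code_def
      using pointed_proper_points[OF x] pointed_proper_points[OF y] by blast
  next
    assume "(code x, code y) \<in> GH_relation"
    then have "coarsely_embeds 1 (line (points x)) (line (points y))"
      unfolding code_def
      by (rule GH_relationD[OF pointed_proper_points[OF y]])
    then obtain C where "\<forall>\<^sub>F n in sequentially.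
        real (n + x n) / 1 - C \<le> real (n + y n) \<and> real (n + y n) \<le> 1 * real (n + x n) + C"
      using coarsely_embeds_imp_gap[OF x y order.refl] by blast
    then have "\<forall>\<^sub>F n in sequentially. \<bar>real (x n) - real (y n)\<bar> \<le> C"
      by eventually_elim auto
    then show "(x, y) \<in> Ksigma_relation" by (rule eventually_imp_Ksigma_relation[OF x y])
  qed
  then show ?thesis
    unfolding continuously_reducible_def using continuous_code by blast
qed

text \<open>Quotients of the gaps are powers of 2 whose exponents are the differences of the terms,
  so bounded factors correspond to bounded differences.\<close>

lemma Ksigma_reducible_QI:
  "continuously_reducible Ksigma_space Ksigma_relation gromov_topology QI_relation"
proof -
  interpret gap_function "\<lambda>n k. 2 ^ (n + k)" by (rule gap_function_power)
  have "(x, y) \<in> Ksigma_relation \<longleftrightarrow> (code x, code y) \<in> QI_relation"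
    if x: "x \<in> topspace Ksigma_space" and y: "y \<in> topspace Ksigma_space" for x y
  proof
    assume "(x, y) \<in> Ksigma_relation"
    then obtain K where K: "\<And>n. n \<ge> 2 \<Longrightarrow> \<bar>real (x n) - real (y n)\<bar> \<le> K"
      unfolding Ksigma_relation_iff[OF x y] by blast
    obtain k :: nat where k: "K \<le> real k" using real_arch_simple by blast
    \<comment> \<open>\<open>2 ^ k\<close> covers the difference of the terms; the additional 2 in
      the exponent supplies the factor 4 demanded by \<open>point_stretch\<close>.\<close>
    have le: "(2::real) ^ (n + a) \<le> 2 ^ (k + 2) * 2 ^ (n + b)"
      if "real a \<le> real b + real k" for n a b
      unfolding power_add[symmetric] using that by (intro power_increasing) auto
    have "(2::real) ^ (n + y n) \<le> 2 ^ (k + 2) * 2 ^ (n + x n)"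
      "(2::real) ^ (n + x n) \<le> 2 ^ (k + 2) * 2 ^ (n + y n)" if "2 \<le> n" for n
      using K[OF that] k by (intro le; linarith)+
    then have "quasi_isometric (line (points x)) (line (points y))"
      by (intro quasi_isometric_points[OF x y, of "2 ^ (k + 2)"]) auto
    then show "(code x, code y) \<in> QI_relation"
      unfolding QI_relation_def code_def
      using pointed_proper_points[OF x] pointed_proper_points[OF y] by blast
  next
    assume "(code x, code y) \<in> QI_relation"
    then obtain L where L: "L \<ge> 1" "coarsely_embeds L (line (points x)) (line (points y))"
      unfolding code_def
      by (rule QI_relationD[OF pointed_proper_points[OF y]])
    obtain C where C: "\<forall>\<^sub>F n in sequentially.
        2 ^ (n + x n) / L - C \<le> 2 ^ (n + y n) \<and> 2 ^ (n + y n) \<le> L * 2 ^ (n + x n) + C"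
      using coarsely_embeds_imp_gap[OF x y L] by blast
    \<comment> \<open>The factor 2 is for the additive error: from \<open>N\<close> on,
      \<open>C\<close> is at most \<open>2 ^ n\<close> and hence at most either gap.\<close>
    obtain k where k: "2 * L \<le> 2 ^ k"
      using real_arch_pow[of 2 "2 * L"] by (auto intro: less_imp_le)
    obtain N :: nat where N: "C \<le> real N" using real_arch_simple by blast
    have "\<forall>\<^sub>F n in sequentially. \<bar>real (x n) - real (y n)\<bar> \<le> real k"
      using C eventually_ge_at_top[of N]
    proof eventually_elim
      case (elim n)
      have "real n \<le> 2 ^ n" by (rule less_imp_le[OF of_nat_less_two_power])
      with elim(2) N have "C \<le> 2 ^ n" by linarith
      moreover have "(2::real) ^ n \<le> 2 ^ (n + x n)" "(2::real) ^ n \<le> 2 ^ (n + y n)"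
        by (auto intro: power_increasing)
      ultimately have C_le: "C \<le> 2 ^ (n + x n)" "C \<le> 2 ^ (n + y n)" by linarith+
      have "b \<le> a + k" if "(2::real) ^ (n + b) \<le> 2 * L * 2 ^ (n + a)" for a b
      proof -
        have "(2::real) ^ (n + b) \<le> 2 ^ k * 2 ^ (n + a)"
          by (intro order_trans[OF that mult_right_mono[OF k]]) simp
        then have "(2::real) ^ (n + b) \<le> 2 ^ (k + (n + a))" by (simp add: power_add)
        then show ?thesis by (subst (asm) power_increasing_iff) auto
      qed
      moreover have "1 * 2 ^ (n + x n) \<le> L * 2 ^ (n + x n)"
        using L(1) by (intro mult_right_mono) auto
      then have "2 ^ (n + y n) \<le> 2 * L * 2 ^ (n + x n)"
        using elim(1) C_le(1) by linarith
      moreover have "2 ^ (n + x n) / L \<le> 2 * 2 ^ (n + y n)"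
        using elim(1) C_le(2) by simp
      then have "2 ^ (n + x n) \<le> 2 * L * 2 ^ (n + y n)"
        using L(1) by (simp add: field_simps)
      ultimately have "y n \<le> x n + k" "x n \<le> y n + k" by simp_all
      then show ?case by linarith
    qed
    then show "(x, y) \<in> Ksigma_relation" by (rule eventually_imp_Ksigma_relation[OF x y])
  qed
  then show ?thesis
    unfolding continuously_reducible_def using continuous_code by blast
qed

theorem proposition4p1:
  shows "continuously_reducible Ksigma_space Ksigma_relation gromov_topology GH_relation \<and>
         continuously_reducible Ksigma_space Ksigma_relation gromov_topology QI_relation"
  using Ksigma_reducible_GH Ksigma_reducible_QI ..

end
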